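(* For $i=1,2$ let $U_i$ be an $(h,k_i)_q$-evasive subspace of $V_i=V(r_i,q^n)$. Then $U=U_1\oplus U_2$ is an $(h,k_1+k_2-h)_q$-evasive subspace of $V=V_1\oplus V_2$.
   Context: $V(m,q^n)$ denotes an $m$-dimensional vector space over $\mathbb{F}_{q^n}$, viewed also as an $mn$-dimensional vector space over $\mathbb{F}_q$. For positive integers $h,k$, an $\mathbb{F}_q$-subspace $U$ of an $\mathbb{F}_{q^n}$-vector space $V$ is called $(h,k)_q$-evasive if $\langle U\rangle_{\mathbb{F}_{q^n}}$ has $\mathbb{F}_{q^n}$-dimension at least $h$ and every $h$-dimensional $\mathbb{F}_{q^n}$-subspace of $V$ meets $U$ in an $\mathbb{F}_q$-subspace of $\mathbb{F}_q$-dimension at most $k$. *)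

theory Defs
  imports "HOL-Analysis.Product_Vector"
begin

text \<open>The extension of $F_{q^n}$ over $F_q$ is given by a field embedding \<open>\<iota>\<close> of a type \<open>'k\<close>
  (playing the role of $F_q$) into a type \<open>'a\<close> (playing the role of $F_{q^n}$); injectivity is
  automatic for fields.\<close>

definition field_embedding :: "('k::field \<Rightarrow> 'a::field) \<Rightarrow> bool" where
  "field_embedding \<iota> \<longleftrightarrow>
     \<iota> 1 = 1 \<and> (\<forall>x y. \<iota> (x + y) = \<iota> x + \<iota> y) \<and> (\<forall>x y. \<iota> (x * y) = \<iota> x * \<iota> y)"

definition restrict_scalars ::
    "('k::field \<Rightarrow> 'a::field) \<Rightarrow> ('a \<Rightarrow> 'v::ab_group_add \<Rightarrow> 'v) \<Rightarrow> 'k \<Rightarrow> 'v \<Rightarrow> 'v" where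
  "restrict_scalars \<iota> s c v = s (\<iota> c) v"

text \<open>The library's \<^term>\<open>vector_space.dim\<close> is 0 on infinite-dimensional sets, so the following is
  meant for a vector space \<open>'v\<close> of finite dimension over \<open>'a\<close>, with \<open>'a\<close> finite over \<open>'k\<close>.\<close>

definition evasive ::
    "('k::field \<Rightarrow> 'a::field) \<Rightarrow> ('a \<Rightarrow> 'v::ab_group_add \<Rightarrow> 'v) \<Rightarrow> nat \<Rightarrow> nat \<Rightarrow> 'v set \<Rightarrow> bool" where
  "evasive \<iota> s h k U \<longleftrightarrow>
     0 < h \<and> 0 < k \<and>
     module.subspace (restrict_scalars \<iota> s) U \<and>
     h \<le> vector_space.dim s (module.span s U) \<and>
     (\<forall>W. module.subspace s W \<and> vector_space.dim s W = h \<longrightarrow>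
          vector_space.dim (restrict_scalars \<iota> s) (W \<inter> U) \<le> k)"

end

theory Submission
  imports Defs
begin

text \<open>Let \<open>W\<close> be an \<open>h\<close>-dimensional subspace of the product, \<open>W\<^sub>1\<close> the kernel of the second projection
  on \<open>W\<close> and \<open>W\<^sub>2\<close> its image, of dimensions \<open>a\<close> and \<open>h - a\<close>. Rank-nullity over the small field bounds
  the dimension of \<open>W \<inter> (U\<^sub>1 \<times> U\<^sub>2)\<close> by those of \<open>W\<^sub>1 \<inter> U\<^sub>1\<close> and \<open>W\<^sub>2 \<inter> U\<^sub>2\<close> together. An \<open>(h, k)\<close>-evasive
  subspace \<open>U\<close> is \<open>(h - j, k - j)\<close>-evasive: as \<open>U\<close> spans at least \<open>h\<close> dimensions, a smaller subspace
  can be enlarged by one dimension by a vector of \<open>U\<close>. So the two intersections have dimensions at most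
  \<open>k\<^sub>1 - (h - a)\<close> and \<open>k\<^sub>2 - a\<close>.\<close>

lemma (in finite_dimensional_vector_space_pair) dim_kernel_image:
  assumes "Vector_Spaces.linear s1 s2 f" and S: "vs1.subspace S"
  shows "vs1.dim S = vs1.dim {x \<in> S. f x = 0} + vs2.dim (f ` S)"
proof -
  interpret f: Vector_Spaces.linear s1 s2 f by fact
  obtain g where g: "range g \<subseteq> S" "Vector_Spaces.linear s2 s1 g" "\<And>y. y \<in> f ` S \<Longrightarrow> f (g y) = y"
    using linear_exists_right_inverse_on[OF assms] by blast
  interpret g: Vector_Spaces.linear s2 s1 g by fact
  interpret swap: finite_dimensional_vector_space_pair s2 B2 s1 B1 by unfold_locales
  let ?K = "{x \<in> S. f x = 0}" and ?C = "g ` (f ` S)"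
  have fS: "vs2.subspace (f ` S)" by (rule f.subspace_image[OF S])
  have K: "vs1.subspace ?K"
    using vs1.subspace_inter[OF S f.subspace_kernel] by (simp add: Int_def)
  have C: "vs1.subspace ?C" by (rule g.subspace_image[OF fS])
  have "inj_on g (vs2.span (f ` S))"
    unfolding vs2.span_eq_iff[THEN iffD2, OF fS] using g(3) by (rule inj_on_inverseI)
  then have dC: "vs1.dim ?C = vs2.dim (f ` S)"
    by (rule swap.dim_image_eq[OF g(2)])
  have "?K \<inter> ?C \<subseteq> {0}"
    using g(3) by (auto simp: g.zero)
  then have d0: "vs1.dim (?K \<inter> ?C) = 0"
    by (simp only: vs1.dim_eq_0)
  have "S = {x + y |x y. x \<in> ?K \<and> y \<in> ?C}"
  proof (intro equalityI subsetI)
    fix x assume x: "x \<in> S"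
    have "g (f x) \<in> S" using g(1) by auto
    then have "x - g (f x) \<in> ?K"
      using x g(3) vs1.subspace_diff[OF S] by (auto simp: f.diff)
    moreover have "g (f x) \<in> ?C" using x by auto
    ultimately show "x \<in> {x + y |x y. x \<in> ?K \<and> y \<in> ?C}"
      by (intro CollectI exI[of _ "x - g (f x)"] exI[of _ "g (f x)"]) simp
  next
    fix x assume "x \<in> {x + y |x y. x \<in> ?K \<and> y \<in> ?C}"
    then show "x \<in> S" using g(1) vs1.subspace_add[OF S] by auto
  qed
  then show ?thesis
    using vs1.dim_sums_Int[OF K C] dC d0 by simp
qed

text \<open>Rank-nullity for \<open>snd\<close> on \<open>W\<close>, whose kernel is the injective
  image of the section under \<open>x \<mapsto> (x, 0)\<close>. It is used over both fields.\<close>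

lemma (in finite_dimensional_vector_space_prod) dim_section_projection:
  assumes "p.subspace W"
  shows "p.dim W = vs1.dim {x. (x, 0) \<in> W} + vs2.dim (snd ` W)"
proof -
  interpret snd: Vector_Spaces.linear scale s2 snd
    by unfold_locales (auto simp: scale_def)
  interpret p2: finite_dimensional_vector_space_pair scale Basis_pair s2 B2
    by unfold_locales
  interpret incl: Vector_Spaces.linear s1 scale "\<lambda>x. (x, 0)"
    by unfold_locales (auto simp: scale_def)
  interpret p1: finite_dimensional_vector_space_pair s1 B1 scale Basis_pair
    by unfold_locales
  have "{x \<in> W. snd x = 0} = (\<lambda>x. (x, 0)) ` {x. (x, 0) \<in> W}"
    by force
  moreover have "p.dim ((\<lambda>x. (x, 0)) ` {x. (x, 0) \<in> W}) = vs1.dim {x. (x, 0) \<in> W}"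
    by (rule p1.dim_image_eq[OF incl.linear_axioms]) (simp add: inj_on_def)
  ultimately show ?thesis
    using p2.dim_kernel_image[OF snd.linear_axioms assms] by simp
qed

text \<open>Adding one vector to a finite set replaces the span by a union of translates, one per
  scalar. Finiteness of the whole space later makes any basis over the small field finite.\<close>

lemma (in finite_dimensional_vector_space) finite_UNIV_if_finite_scalars:
  assumes "finite (UNIV :: 'a set)"
  shows "finite (UNIV :: 'b set)"
proof -
  have "finite (span S)" if "finite S" for S
    using that
  proof (induction S)
    case (insert a S)
    have "span (insert a S) \<subseteq> (\<Union>c. (\<lambda>y. y + c *s a) ` span S)"
    proof
      fix x assume "x \<in> span (insert a S)"
      then obtain c where "x - c *s a \<in> span S" by (auto simp: span_insert)
      then have "(x - c *s a) + c *s a \<in> (\<lambda>y. y + c *s a) ` span S" by (rule imageI)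
      then show "x \<in> (\<Union>c. (\<lambda>y. y + c *s a) ` span S)" by auto
    qed
    moreover have "finite (\<Union>c. (\<lambda>y. y + c *s a) ` span S)"
      using insert.IH assms by blast
    ultimately show ?case by (rule finite_subset)
  qed simp
  then show ?thesis using finite_Basis span_Basis by metis
qed

lemma vector_space_restrict_scalars:
  assumes "field_embedding \<iota>" and "vector_space s"
  shows "vector_space (restrict_scalars \<iota> s)"
proof -
  interpret vector_space s by fact
  show ?thesis
    using assms(1)
    by unfold_locales
      (auto simp: restrict_scalars_def field_embedding_def scale_left_distrib scale_right_distrib)
qed

lemma finite_dimensional_restrict_scalars:
  fixes s :: "'a::field \<Rightarrow> 'v::ab_group_add \<Rightarrow> 'v"
  assumes "field_embedding \<iota>" and "finite_dimensional_vector_space s B"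
    and "finite (UNIV :: 'a set)"
  obtains C where "finite_dimensional_vector_space (restrict_scalars \<iota> s) C"
proof -
  interpret finite_dimensional_vector_space s B by fact
  interpret K: vector_space "restrict_scalars \<iota> s"
    by (rule vector_space_restrict_scalars[OF assms(1) vector_space_axioms])
  obtain C where C: "K.independent C" "UNIV \<subseteq> K.span C"
    using K.maximal_independent_subset[of UNIV] by blast
  have "finite C"
    using finite_UNIV_if_finite_scalars[OF assms(3)] by (rule rev_finite_subset) simp
  then show thesis
    using C by (intro that[of C]) (unfold_locales, auto)
qed

text \<open>Restricting scalars commutes with products, so product results over the small field
  apply to the restricted structure that \<open>evasive\<close> refers to.\<close>

lemma restrict_scalars_module_prod:
  assumes "field_embedding \<iota>" and "vector_space s1" and "vector_space s2"
  shows "restrict_scalars \<iota> (module_prod.scale s1 s2) =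
    module_prod.scale (restrict_scalars \<iota> s1) (restrict_scalars \<iota> s2)"
proof -
  interpret v1: vector_space s1 by fact
  interpret v2: vector_space s2 by fact
  interpret K1: vector_space "restrict_scalars \<iota> s1"
    by (rule vector_space_restrict_scalars[OF assms(1,2)])
  interpret K2: vector_space "restrict_scalars \<iota> s2"
    by (rule vector_space_restrict_scalars[OF assms(1,3)])
  interpret module_prod s1 s2 by unfold_locales
  interpret K: module_prod "restrict_scalars \<iota> s1" "restrict_scalars \<iota> s2" by unfold_locales
  show ?thesis
    by (simp add: fun_eq_iff restrict_scalars_def scale_def K.scale_def)
qed

locale finite_scalar_restriction =
  finite_dimensional_vector_space s B +
  K: finite_dimensional_vector_space "restrict_scalars \<iota> s" C
  for \<iota> :: "'k::field \<Rightarrow> 'a::field" and s :: "'a \<Rightarrow> 'v::ab_group_add \<Rightarrow> 'v"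
    and B C :: "'v set"
begin

lemma subspace_restrict_scalars: "subspace W \<Longrightarrow> K.subspace W"
  by (simp add: subspace_def K.subspace_def restrict_scalars_def)

text \<open>The induction climbs from \<open>W\<close> to dimension \<open>h\<close>: adjoining a
  vector of \<open>U\<close> outside \<open>W\<close> raises \<open>dim W\<close> by exactly one and
  the dimension of the intersection by at least one. The additive form avoids truncated
  subtraction.\<close>

lemma evasive_dim_Int_le:
  assumes ev: "evasive \<iota> s h k U" and "subspace W" and "dim W \<le> h"
  shows "K.dim (W \<inter> U) + h \<le> k + dim W"
  using assms(2,3)
proof (induction "h - dim W" arbitrary: W)
  case 0
  then show ?case using ev by (simp add: evasive_def)
next
  case (Suc j)
  have "dim W < h" using Suc.hyps(2) by simp
  have U: "K.subspace U" and hU: "h \<le> dim (span U)"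
    using ev by (auto simp: evasive_def)
  \<comment> \<open>Otherwise the span of \<open>U\<close> would have dimension at most
    \<open>dim W < h\<close>.\<close>
  have "\<not> U \<subseteq> W"
    using dim_subset[of U W] hU \<open>dim W < h\<close> by auto
  then obtain u where u: "u \<in> U" "u \<notin> W" by blast
  let ?W = "span (insert u W)"
  have spanW: "span W = W" using Suc.prems(1) by simp
  have dW: "dim ?W = dim W + 1" using u(2) by (simp add: dim_insert spanW)
  have "K.subspace (W \<inter> U)"
    using K.subspace_inter[OF subspace_restrict_scalars[OF Suc.prems(1)] U] .
  then have "u \<notin> K.span (W \<inter> U)"
    using K.span_minimal[OF order_refl] u(2) by blast
  then have "K.dim (W \<inter> U) + 1 = K.dim (insert u (W \<inter> U))"
    by (simp add: K.dim_insert)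
  also have "\<dots> \<le> K.dim (?W \<inter> U)"
    using u(1) by (intro K.dim_subset) (auto intro: span_base)
  finally have "K.dim (W \<inter> U) + 1 \<le> K.dim (?W \<inter> U)" .
  moreover have "K.dim (?W \<inter> U) + h \<le> k + dim ?W"
    using Suc.hyps(2) dW by (intro Suc.hyps(1)) auto
  ultimately show ?case using dW by linarith
qed

text \<open>The zero subspace is the extreme case of the previous bound. The inequality keeps
  \<open>k1 + k2 - h\<close> from truncating and makes it positive.\<close>

lemma evasive_le:
  assumes "evasive \<iota> s h k U"
  shows "h \<le> k"
  using evasive_dim_Int_le[OF assms, of "{0}"] by simp

end

theorem theorem2p9:
  fixes \<iota> :: "'k::{field,finite} \<Rightarrow> 'a::{field,finite}"
    and s1 :: "'a \<Rightarrow> 'v1::ab_group_add \<Rightarrow> 'v1" and B1 :: "'v1 set"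
    and s2 :: "'a \<Rightarrow> 'v2::ab_group_add \<Rightarrow> 'v2" and B2 :: "'v2 set"
    and q n r1 r2 h k1 k2 :: nat
    and U1 :: "'v1 set" and U2 :: "'v2 set"
  assumes "field_embedding \<iota>"
    and "card (UNIV :: 'k set) = q" and "n \<ge> 1" and "card (UNIV :: 'a set) = q ^ n"
    and "finite_dimensional_vector_space s1 B1" and "vector_space.dim s1 UNIV = r1"
    and "finite_dimensional_vector_space s2 B2" and "vector_space.dim s2 UNIV = r2"
    and "evasive \<iota> s1 h k1 U1"
    and "evasive \<iota> s2 h k2 U2"
  shows "evasive \<iota> (module_prod.scale s1 s2) h (k1 + k2 - h) (U1 \<times> U2)"
proof -
  interpret v1: finite_dimensional_vector_space s1 B1 by fact
  interpret v2: finite_dimensional_vector_space s2 B2 by fact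
  obtain C1 where C1: "finite_dimensional_vector_space (restrict_scalars \<iota> s1) C1"
    using finite_dimensional_restrict_scalars[OF assms(1,5)] by auto
  obtain C2 where C2: "finite_dimensional_vector_space (restrict_scalars \<iota> s2) C2"
    using finite_dimensional_restrict_scalars[OF assms(1,7)] by auto
  interpret K1: finite_dimensional_vector_space "restrict_scalars \<iota> s1" C1 by fact
  interpret K2: finite_dimensional_vector_space "restrict_scalars \<iota> s2" C2 by fact
  interpret E1: finite_scalar_restriction \<iota> s1 B1 C1 by unfold_locales
  interpret E2: finite_scalar_restriction \<iota> s2 B2 C2 by unfold_locales
  interpret V: finite_dimensional_vector_space_prod s1 s2 B1 B2 by unfold_locales
  interpret K: finite_dimensional_vector_space_prod
    "restrict_scalars \<iota> s1" "restrict_scalars \<iota> s2" C1 C2 by unfold_locales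
  have restrict: "restrict_scalars \<iota> V.scale = K.scale"
    by (rule restrict_scalars_module_prod[OF assms(1) v1.vector_space_axioms v2.vector_space_axioms])
  have U1: "K1.subspace U1" and hU1: "h \<le> v1.dim (v1.span U1)" and "0 < h"
    using assms(9) by (auto simp: evasive_def)
  have U2: "K2.subspace U2"
    using assms(10) by (auto simp: evasive_def)
  have "h \<le> k1" "h \<le> k2"
    using E1.evasive_le[OF assms(9)] E2.evasive_le[OF assms(10)] .
  have U: "K.p.subspace (U1 \<times> U2)"
    using U1 U2 by (rule K.subspace_Times)
  \<comment> \<open>The first factor alone already spans enough: \<open>U1 \<times> {0}\<close> lies
    in \<open>U1 \<times> U2\<close>.\<close>
  have "h \<le> V.p.dim (v1.span U1 \<times> {0})"
    using hU1 V.dim_Times[OF v1.subspace_span v2.subspace_single_0, of U1] by simp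
  also have "\<dots> = V.p.dim (U1 \<times> {0})"
    by (simp flip: V.span_Times_sing2)
  also have "\<dots> \<le> V.p.dim (V.p.span (U1 \<times> U2))"
    using K2.subspace_0[OF U2] by (simp, intro V.p.dim_subset) auto
  finally have span_ge: "h \<le> V.p.dim (V.p.span (U1 \<times> U2))" .
  have "K.p.dim (W \<inter> U1 \<times> U2) \<le> k1 + k2 - h"
    if W: "V.p.subspace W" and dW: "V.p.dim W = h" for W
  proof -
    let ?W1 = "{x. (x, 0) \<in> W}" and ?W2 = "snd ` W"
    have W1: "v1.subspace ?W1"
      using W by (force simp: v1.subspace_def V.p.subspace_def V.scale_def zero_prod_def)
    interpret snd: Vector_Spaces.linear V.scale s2 snd
      by unfold_locales (auto simp: V.scale_def)
    have W2: "v2.subspace ?W2"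
      by (rule snd.subspace_image[OF W])
    have d: "v1.dim ?W1 + v2.dim ?W2 = h"
      using V.dim_section_projection[OF W] dW by simp
    have "K.scale c w = V.scale (\<iota> c) w" for c w
      by (simp add: restrict_scalars_def flip: restrict)
    then have "K.p.subspace W"
      using W by (simp add: V.p.subspace_def K.p.subspace_def)
    then have "K.p.subspace (W \<inter> U1 \<times> U2)"
      using U by (rule K.p.subspace_inter)
    then have "K.p.dim (W \<inter> U1 \<times> U2) =
        K1.dim {x. (x, 0) \<in> W \<inter> U1 \<times> U2} + K2.dim (snd ` (W \<inter> U1 \<times> U2))"
      by (rule K.dim_section_projection)
    \<comment> \<open>The section of the intersection lies in \<open>?W1 \<inter> U1\<close>; its
      projection lies in \<open>?W2 \<inter> U2\<close>, possibly properly.\<close>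
    also have "\<dots> \<le> K1.dim (?W1 \<inter> U1) + K2.dim (?W2 \<inter> U2)"
      by (intro add_mono K1.dim_subset K2.dim_subset) auto
    \<comment> \<open>By \<open>d\<close> both dimensions are at most \<open>h\<close>, and summing
      the two bounds gives at most \<open>k1 + k2 + h - 2 * h\<close>.\<close>
    finally show ?thesis
      using E1.evasive_dim_Int_le[OF assms(9) W1] E2.evasive_dim_Int_le[OF assms(10) W2] d
      by linarith
  qed
  then show ?thesis
    using \<open>0 < h\<close> \<open>h \<le> k1\<close> \<open>h \<le> k2\<close> U span_ge
    by (auto simp: evasive_def restrict)
qed

end
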